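(* Let $A,B$ be Banach algebras, $X$ a Banach $A$--$B$ bimodule, $\sigma=(\sigma_A,\sigma_B),\tau=(\tau_A,\tau_B)\in\operatorname{Aut}(A)\times\operatorname{Aut}(B)$, $\alpha\in\operatorname{Aut}(A)$ and $\beta\in\operatorname{Aut}(B)$. Assume $\tau_A=\alpha\sigma_A\alpha^{-1}$ and $\tau_B=\beta\sigma_B\beta^{-1}$, and let $u:X\to X$ be an $(\alpha,\beta)$-bimodule isomorphism. For a bounded bilinear map $\theta:A\times B\to X$ define $$\theta_\sigma(a,b):=u^{-1}\bigl(\theta(\alpha(a),\beta(b))\bigr)\qquad(a\in A,\ b\in B).$$ Then $\theta$ satisfies $$\theta(aa',bb')=\tau_A(\alpha(a))\cdot\theta(a',b')+\theta(a,b)\cdot\tau_B(\beta(b'))\qquad\text{for all }a,a'\in A,\ b,b'\in B$$ if and only if $\theta_\sigma$ satisfies $$\theta_\sigma(aa',bb')=\sigma_A(a)\cdot\theta_\sigma(a',b')+\theta_\sigma(a,b)\cdot\sigma_B(b')\qquad\text{for all }a,a'\in A,\ b,b'\in B.$$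
   Context: Fix a scalar field $\mathbb{K}\in\{\mathbb{R},\mathbb{C}\}$. All algebras are Banach $\mathbb{K}$-algebras, all homomorphisms (in particular automorphisms, elements of $\operatorname{Aut}(\cdot)$) are bounded and $\mathbb{K}$-linear. A Banach $A$--$B$ bimodule $X$ is a Banach space with commuting bounded left $A$-action and right $B$-action. For $\alpha\in\operatorname{Aut}(A)$, $\beta\in\operatorname{Aut}(B)$, an $(\alpha,\beta)$-bimodule isomorphism is a bounded (linear) bijection $u:X\to X$ with $u(a\cdot x\cdot b)=\alpha(a)\cdot u(x)\cdot\beta(b)$ for all $a\in A$, $x\in X$, $b\in B$.
   Formalization: The bimodule isomorphism u is also required to satisfy the one-sided identities u(a·x)=α(a)·u(x) and u(x·b)=u(x)·β(b); with only the two-sided identity the claim fails for degenerate (non-unital) modules. *)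

theory Defs
  imports "HOL-Analysis.Analysis"
begin

text \<open>The scalar field is the real or the complex field, up to isometric field isomorphism.
  A type class allows one statement to cover both cases.\<close>

class real_or_complex = real_normed_field +
  assumes real_or_complex:
    "(\<exists>f :: 'a \<Rightarrow> real. bij f \<and> (\<forall>x y. f (x + y) = f x + f y) \<and>
        (\<forall>x y. f (x * y) = f x * f y) \<and> (\<forall>x. norm (f x) = norm x)) \<or>
     (\<exists>f :: 'a \<Rightarrow> complex. bij f \<and> (\<forall>x y. f (x + y) = f x + f y) \<and>
        (\<forall>x y. f (x * y) = f x * f y) \<and> (\<forall>x. norm (f x) = norm x))"

instance real :: real_or_complex
  by standard (rule disjI1, rule exI[of _ "\<lambda>x. x"], simp add: bij_def inj_on_def)

instance complex :: real_or_complex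
  by standard (rule disjI2, rule exI[of _ "\<lambda>x. x"], simp add: bij_def inj_on_def)

text \<open>The type classes supply the norm, completeness and the underlying real structure;
  the scalar multiplication by the field is an explicit operation extending the real one.\<close>

locale banach_space_over = vector_space scale
  for scale :: "'k::real_or_complex \<Rightarrow> 'x::banach \<Rightarrow> 'x" +
  assumes scale_of_real: "scale (of_real c) x = c *\<^sub>R x"
    and norm_scale: "norm (scale k x) = norm k * norm x"

text \<open>Algebras are associative, not necessarily unital; submultiplicativity of the norm is part
  of the class \<^class>\<open>real_normed_algebra\<close>.\<close>

locale banach_algebra_over = banach_space_over scale
  for scale :: "'k::real_or_complex \<Rightarrow> 'a::{real_normed_algebra, banach} \<Rightarrow> 'a" +
  assumes scale_mult_left: "scale k x * y = scale k (x * y)"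
    and scale_mult_right: "x * scale k y = scale k (x * y)"

definition bounded_linear_over ::
    "('k::real_or_complex \<Rightarrow> 'x::banach \<Rightarrow> 'x) \<Rightarrow> ('k \<Rightarrow> 'y::banach \<Rightarrow> 'y) \<Rightarrow> ('x \<Rightarrow> 'y) \<Rightarrow> bool"
  where "bounded_linear_over s t f \<longleftrightarrow>
    Vector_Spaces.linear s t f \<and> (\<exists>M. \<forall>x. norm (f x) \<le> M * norm x)"

definition bounded_bilinear_over ::
    "('k::real_or_complex \<Rightarrow> 'x::banach \<Rightarrow> 'x) \<Rightarrow> ('k \<Rightarrow> 'y::banach \<Rightarrow> 'y) \<Rightarrow>
     ('k \<Rightarrow> 'z::banach \<Rightarrow> 'z) \<Rightarrow> ('x \<Rightarrow> 'y \<Rightarrow> 'z) \<Rightarrow> bool"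
  where "bounded_bilinear_over s t r f \<longleftrightarrow>
    (\<forall>y. Vector_Spaces.linear s r (\<lambda>x. f x y)) \<and>
    (\<forall>x. Vector_Spaces.linear t r (\<lambda>y. f x y)) \<and>
    (\<exists>M. \<forall>x y. norm (f x y) \<le> M * norm x * norm y)"

text \<open>Boundedness of the inverse is automatic by the open mapping theorem.\<close>

definition Aut ::
    "('k::real_or_complex \<Rightarrow> 'a::{real_normed_algebra, banach} \<Rightarrow> 'a) \<Rightarrow> ('a \<Rightarrow> 'a) set"
  where "Aut s =
    {f. bounded_linear_over s s f \<and> (\<forall>x y. f (x * y) = f x * f y) \<and> bij f}"

locale banach_bimodule =
  A: banach_algebra_over scaleA + B: banach_algebra_over scaleB + X: banach_space_over scaleX
  for scaleA :: "'k::real_or_complex \<Rightarrow> 'a::{real_normed_algebra, banach} \<Rightarrow> 'a"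
    and scaleB :: "'k \<Rightarrow> 'b::{real_normed_algebra, banach} \<Rightarrow> 'b"
    and scaleX :: "'k \<Rightarrow> 'x::banach \<Rightarrow> 'x" +
  fixes lact :: "'a \<Rightarrow> 'x \<Rightarrow> 'x"
    and ract :: "'x \<Rightarrow> 'b \<Rightarrow> 'x"
  assumes lact_bounded_bilinear: "bounded_bilinear_over scaleA scaleX scaleX lact"
    and ract_bounded_bilinear: "bounded_bilinear_over scaleX scaleB scaleX ract"
    and lact_mult: "lact (a * a') x = lact a (lact a' x)"
    and ract_mult: "ract x (b * b') = ract (ract x b) b'"
    and lact_ract: "ract (lact a x) b = lact a (ract x b)"

text \<open>An isomorphism of bimodules, where \<open>a \<in> A\<close> acts on the target through \<open>\<alpha> a\<close> and
  \<open>b \<in> B\<close> through \<open>\<beta> b\<close>. The identity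
  \<open>u (a \<cdot> x \<cdot> b) = \<alpha> a \<cdot> u x \<cdot> \<beta> b\<close> is understood, as usual for bimodules,
  to hold also when one of the factors \<open>a\<close>, \<open>b\<close> is absent. Without units
  the two one-sided identities do not follow from the two-sided one, which for instance is
  vacuous if \<open>B\<close> acts by zero.\<close>

definition bimodule_iso ::
    "('k::real_or_complex \<Rightarrow> 'x::banach \<Rightarrow> 'x) \<Rightarrow> ('a \<Rightarrow> 'x \<Rightarrow> 'x) \<Rightarrow> ('x \<Rightarrow> 'b \<Rightarrow> 'x) \<Rightarrow>
     ('a \<Rightarrow> 'a) \<Rightarrow> ('b \<Rightarrow> 'b) \<Rightarrow> ('x \<Rightarrow> 'x) \<Rightarrow> bool"
  where "bimodule_iso scaleX lact ract \<alpha> \<beta> u \<longleftrightarrow>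
    bounded_linear_over scaleX scaleX u \<and> bij u \<and>
    (\<forall>a x b. u (ract (lact a x) b) = ract (lact (\<alpha> a) (u x)) (\<beta> b)) \<and>
    (\<forall>a x. u (lact a x) = lact (\<alpha> a) (u x)) \<and>
    (\<forall>x b. u (ract x b) = ract (u x) (\<beta> b))"

definition twist ::
    "('x \<Rightarrow> 'x) \<Rightarrow> ('a \<Rightarrow> 'a) \<Rightarrow> ('b \<Rightarrow> 'b) \<Rightarrow> ('a \<Rightarrow> 'b \<Rightarrow> 'x) \<Rightarrow> 'a \<Rightarrow> 'b \<Rightarrow> 'x"
  where "twist u \<alpha> \<beta> \<theta> a b = inv u (\<theta> (\<alpha> a) (\<beta> b))"

end

theory Submission
  imports Defs
begin

text \<open>Write \<open>D(p, q)\<close> for the identity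
  \<open>\<theta> (a a') (b b') = p a \<cdot> \<theta> a' b' + \<theta> a b \<cdot> q b'\<close>.
  Conjugating by \<open>u\<close>, \<open>\<alpha>\<close> and \<open>\<beta>\<close> turns \<open>D(\<sigma>A, \<sigma>B)\<close> for \<open>\<theta>\<sigma>\<close> into
  \<open>D(\<tau>A, \<tau>B)\<close> for \<open>\<theta>\<close>, since \<open>\<tau>A \<circ> \<alpha> = \<alpha> \<circ> \<sigma>A\<close> and
  \<open>\<tau>B \<circ> \<beta> = \<beta> \<circ> \<sigma>B\<close> (lemma \<open>twisted_leibniz_twist_iff\<close>). The theorem, however, speaks of
  \<open>D(\<tau>A \<circ> \<alpha>, \<tau>B \<circ> \<beta>)\<close> for \<open>\<theta>\<close>, so one has to pass between two different pairs of twists.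

  This is possible because the identity is very rigid for a map that is additive in each
  variable separately. The substitution \<open>a' = 0\<close> kills every term but \<open>\<theta> a b \<cdot> q b'\<close>, and
  \<open>b = 0\<close> kills every term but \<open>p a \<cdot> \<theta> a' b'\<close>. Thus all three terms vanish identically. If
  \<open>p\<close> and \<open>q\<close> are onto, what remains says that \<open>\<theta>\<close> vanishes on products and that its values
  are annihilated by both actions, a condition in which \<open>p\<close> and \<open>q\<close> do not occur
  (lemma \<open>twisted_leibniz_iff_annihilated\<close>). So \<open>D(p, q)\<close> is one and the same condition for
  all pairs of surjections.\<close>

definition twisted_leibniz ::
    "('a::times \<Rightarrow> 'x::plus \<Rightarrow> 'x) \<Rightarrow> ('x \<Rightarrow> 'b::times \<Rightarrow> 'x) \<Rightarrow> ('a \<Rightarrow> 'a) \<Rightarrow> ('b \<Rightarrow> 'b) \<Rightarrow>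
     ('a \<Rightarrow> 'b \<Rightarrow> 'x) \<Rightarrow> bool"
  where "twisted_leibniz lact ract p q \<theta> \<longleftrightarrow>
    (\<forall>a a' b b'. \<theta> (a * a') (b * b') = lact (p a) (\<theta> a' b') + ract (\<theta> a b) (q b'))"

lemma bounded_bilinear_over_zero:
  assumes "bounded_bilinear_over s t r f"
  shows "f 0 y = 0" and "f x 0 = 0"
proof -
  have "Vector_Spaces.linear s r (\<lambda>x. f x y)" and "Vector_Spaces.linear t r (\<lambda>y. f x y)"
    using assms by (simp_all add: bounded_bilinear_over_def)
  then interpret L: Vector_Spaces.linear s r "\<lambda>x. f x y" + R: Vector_Spaces.linear t r "\<lambda>y. f x y" .
  show "f 0 y = 0" by (rule L.zero)
  show "f x 0 = 0" by (rule R.zero)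
qed

text \<open>Used to exchange one pair of surjective twists for another. Surjectivity makes the elements
  \<open>p a\<close> and \<open>q b'\<close>, which annihilate the values of \<open>\<theta>\<close>, arbitrary.\<close>

lemma twisted_leibniz_iff_annihilated:
  fixes lact :: "'a::mult_zero \<Rightarrow> 'x::monoid_add \<Rightarrow> 'x" and ract :: "'x \<Rightarrow> 'b::mult_zero \<Rightarrow> 'x"
  assumes lact0: "\<And>a. lact a 0 = 0" and ract0: "\<And>b. ract 0 b = 0"
    and \<theta>0: "\<And>b. \<theta> 0 b = 0" "\<And>a. \<theta> a 0 = 0"
    and surj: "surj p" "surj q"
  shows "twisted_leibniz lact ract p q \<theta> \<longleftrightarrow>
    (\<forall>a a' b b'. \<theta> (a * a') (b * b') = 0) \<and>
    (\<forall>c a b. lact c (\<theta> a b) = 0) \<and> (\<forall>a b d. ract (\<theta> a b) d = 0)"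
    (is "?D \<longleftrightarrow> ?Z")
proof
  assume D: ?D
  note leibniz = D[unfolded twisted_leibniz_def, rule_format]
  have l: "lact c (\<theta> a b) = 0" for c a b
  proof -
    obtain a0 where "c = p a0" using surj(1) by (rule surjE)
    then show ?thesis using leibniz[of a0 a 0 b] by (simp add: \<theta>0 ract0)
  qed
  have r: "ract (\<theta> a b) d = 0" for a b d
  proof -
    obtain b' where "d = q b'" using surj(2) by (rule surjE)
    then show ?thesis using leibniz[of a 0 b b'] by (simp add: \<theta>0 lact0)
  qed
  show ?Z using l r leibniz by simp
next
  assume ?Z
  then show ?D by (simp add: twisted_leibniz_def)
qed

text \<open>Transport of structure: \<open>u\<close>, \<open>\<alpha>\<close> and \<open>\<beta>\<close> together carry the identity for the twisted
  map to the identity for \<open>\<theta>\<close> evaluated at \<open>\<alpha> a\<close>, \<open>\<alpha> a'\<close>, \<open>\<beta> b\<close> and \<open>\<beta> b'\<close>, and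
  surjectivity makes these arguments arbitrary.\<close>

lemma twisted_leibniz_twist_iff:
  fixes \<alpha> :: "'a::times \<Rightarrow> 'a" and \<beta> :: "'b::times \<Rightarrow> 'b"
  assumes u: "bimodule_iso scaleX lact ract \<alpha> \<beta> u"
    and \<alpha>: "surj \<alpha>" "\<And>a a'. \<alpha> (a * a') = \<alpha> a * \<alpha> a'"
    and \<beta>: "surj \<beta>" "\<And>b b'. \<beta> (b * b') = \<beta> b * \<beta> b'"
    and p: "\<And>a. p' (\<alpha> a) = \<alpha> (p a)" and q: "\<And>b. q' (\<beta> b) = \<beta> (q b)"
  shows "twisted_leibniz lact ract p q (twist u \<alpha> \<beta> \<theta>) \<longleftrightarrow> twisted_leibniz lact ract p' q' \<theta>"
proof -
  have bij: "bij u" and lin: "Vector_Spaces.linear scaleX scaleX u"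
    and act: "\<And>a x. u (lact a x) = lact (\<alpha> a) (u x)" "\<And>x b. u (ract x b) = ract (u x) (\<beta> b)"
    using u by (simp_all add: bimodule_iso_def bounded_linear_over_def)
  have u_add: "u (x + y) = u x + u y" for x y
    by (rule Vector_Spaces.linear.axioms(3)[OF lin, THEN module_hom.add])
  have u_twist: "u (twist u \<alpha> \<beta> \<theta> a b) = \<theta> (\<alpha> a) (\<beta> b)" for a b
    by (simp add: twist_def surj_f_inv_f[OF bij_is_surj[OF bij]])
  have "twisted_leibniz lact ract p q (twist u \<alpha> \<beta> \<theta>) \<longleftrightarrow>
      (\<forall>a a' b b'. u (twist u \<alpha> \<beta> \<theta> (a * a') (b * b')) =
        u (lact (p a) (twist u \<alpha> \<beta> \<theta> a' b') + ract (twist u \<alpha> \<beta> \<theta> a b) (q b')))"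
    unfolding twisted_leibniz_def inj_eq[OF bij_is_inj[OF bij]] ..
  also have "\<dots> \<longleftrightarrow> (\<forall>a a' b b'. \<theta> (\<alpha> a * \<alpha> a') (\<beta> b * \<beta> b') =
        lact (p' (\<alpha> a)) (\<theta> (\<alpha> a') (\<beta> b')) + ract (\<theta> (\<alpha> a) (\<beta> b)) (q' (\<beta> b')))"
    by (simp only: u_add act u_twist \<alpha>(2) \<beta>(2) p q)
  also have "\<dots> \<longleftrightarrow> twisted_leibniz lact ract p' q' \<theta>"
    unfolding twisted_leibniz_def by (metis \<alpha>(1) \<beta>(1) surjD)
  finally show ?thesis .
qed

theorem lemma2p6:
  fixes scaleA :: "'k::real_or_complex \<Rightarrow> 'a::{real_normed_algebra, banach} \<Rightarrow> 'a"
    and scaleB :: "'k \<Rightarrow> 'b::{real_normed_algebra, banach} \<Rightarrow> 'b"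
    and scaleX :: "'k \<Rightarrow> 'x::banach \<Rightarrow> 'x"
    and lact :: "'a \<Rightarrow> 'x \<Rightarrow> 'x" (infixr "\<cdot>\<^sub>l" 75)
    and ract :: "'x \<Rightarrow> 'b \<Rightarrow> 'x" (infixl "\<cdot>\<^sub>r" 74)
    and \<sigma>A \<tau>A \<alpha> :: "'a \<Rightarrow> 'a"
    and \<sigma>B \<tau>B \<beta> :: "'b \<Rightarrow> 'b"
    and u :: "'x \<Rightarrow> 'x"
    and \<theta> \<theta>\<sigma> :: "'a \<Rightarrow> 'b \<Rightarrow> 'x"
  assumes "banach_bimodule scaleA scaleB scaleX lact ract"
    and "\<sigma>A \<in> Aut scaleA" and "\<sigma>B \<in> Aut scaleB"
    and "\<tau>A \<in> Aut scaleA" and "\<tau>B \<in> Aut scaleB"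
    and "\<alpha> \<in> Aut scaleA" and "\<beta> \<in> Aut scaleB"
    and "\<tau>A = \<alpha> \<circ> \<sigma>A \<circ> inv \<alpha>" and "\<tau>B = \<beta> \<circ> \<sigma>B \<circ> inv \<beta>"
    and "bimodule_iso scaleX lact ract \<alpha> \<beta> u"
    and "bounded_bilinear_over scaleA scaleB scaleX \<theta>"
    and "\<theta>\<sigma> = twist u \<alpha> \<beta> \<theta>"
  shows "(\<forall>a a' b b'. \<theta> (a * a') (b * b') = \<tau>A (\<alpha> a) \<cdot>\<^sub>l \<theta> a' b' + \<theta> a b \<cdot>\<^sub>r \<tau>B (\<beta> b')) \<longleftrightarrow>
    (\<forall>a a' b b'. \<theta>\<sigma> (a * a') (b * b') = \<sigma>A a \<cdot>\<^sub>l \<theta>\<sigma> a' b' + \<theta>\<sigma> a b \<cdot>\<^sub>r \<sigma>B b')"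
proof -
  interpret banach_bimodule scaleA scaleB scaleX lact ract by fact
  have bij: "bij \<alpha>" "bij \<beta>" "bij \<tau>A" "bij \<tau>B"
    and mult: "\<And>a a'. \<alpha> (a * a') = \<alpha> a * \<alpha> a'" "\<And>b b'. \<beta> (b * b') = \<beta> b * \<beta> b'"
    using assms(4-7) by (simp_all add: Aut_def)
  note surj = bij[THEN bij_is_surj]
  have conj: "\<tau>A (\<alpha> a) = \<alpha> (\<sigma>A a)" "\<tau>B (\<beta> b) = \<beta> (\<sigma>B b)" for a b
    using assms(8,9) bij(1,2) by (simp_all add: bij_is_inj)
  note zero = bounded_bilinear_over_zero(2)[OF lact_bounded_bilinear]
    bounded_bilinear_over_zero(1)[OF ract_bounded_bilinear]
    bounded_bilinear_over_zero[OF assms(11)]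
  note annihilated =
    twisted_leibniz_iff_annihilated[where lact = lact and ract = ract and \<theta> = \<theta>, OF zero]
  have "twisted_leibniz lact ract (\<tau>A \<circ> \<alpha>) (\<tau>B \<circ> \<beta>) \<theta> \<longleftrightarrow> twisted_leibniz lact ract \<tau>A \<tau>B \<theta>"
    using annihilated[OF comp_surj[OF surj(1,3)] comp_surj[OF surj(2,4)]]
      annihilated[OF surj(3,4)] by (rule trans[OF _ sym])
  also have "\<dots> \<longleftrightarrow> twisted_leibniz lact ract \<sigma>A \<sigma>B \<theta>\<sigma>"
    unfolding assms(12)
    by (rule twisted_leibniz_twist_iff[OF assms(10), symmetric]) (fact surj mult conj)+
  finally show ?thesis
    by (simp add: twisted_leibniz_def)
qed

end
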